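(* Let $I$ be an ideal of $R=A[\mathbb{R}_{\geq 0}\times\cdots\times\mathbb{R}_{\geq 0}]$ ($d$ factors) generated by a non-empty set of monomials of the form $X_i^aX_j^a$ with $i\neq j$ and $a\in\mathbb{R}_{>0}$, and let $\Gamma_S=(\Gamma,S)$ be the associated graph with interval data. Then there are m-irreducible decompositions $$I=\bigcap_{(W,\sigma)}Q_{W,\sigma}=\bigcap_{(W,\sigma)\text{ min}}Q_{W,\sigma}$$ where the first intersection is taken over all interval vertex covers of $\Gamma_S$, and the second intersection is taken over all minimal interval vertex covers of $\Gamma_S$. The second intersection is finite and irredundant, and $\Gamma_S$ has only finitely many minimal interval vertex covers.
   Context: $A$ is a non-zero commutative ring with identity. The ring $R=A[\mathbb{R}_{\geq 0}\times\cdots\times\mathbb{R}_{\geq 0}]$ ($d$ factors) is the set of all finite $A$-linear combinations of monomials $X_1^{m_1}\cdots X_d^{m_d}$ with $m_i\in\mathbb{R}_{\geq 0}$ (multiplication adds exponents). A monomial ideal is an ideal generated by a set of monomials. A monomial ideal $L$ is m-irreducible if for all monomial ideals $J,K$ of $R$ with $L=J\cap K$ one has $L=J$ or $L=K$. An m-irreducible decomposition of a monomial ideal $I$ is an expression $I=\bigcap_{\lambda\in\Lambda}I_\lambda$ with every $I_\lambda$ an m-irreducible monomial ideal; it is irredundant if $I_\lambda\not\subseteq I_\mu$ for all distinct $\lambda,\mu\in\Lambda$. Data attached to $I$: $\Gamma$ is the finite simple graph with vertex set $V=\{1,\ldots,d\}$ and edge set $E=\{ij\mid i\neq j\text{ and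 }X_i^aX_j^a\in I\text{ for some }a>0\}$, where $ij=\{i,j\}$. For $ij\in E$ set $S(ij)=\{a>0\mid X_i^aX_j^a\in I\}$. Let $\Omega=\{(a,\infty)\mid a\in\mathbb{R}_{\geq 0}\}\cup\{[b,\infty)\mid b\in\mathbb{R}_{>0}\}$; each $S(ij)$ belongs to $\Omega$. Write $\Gamma_S=(\Gamma,S)$. A vertex cover of $\Gamma$ is a subset $W\subseteq V$ such that for every $ij\in E$, $i\in W$ or $j\in W$. An interval vertex cover of $\Gamma_S$ is a pair $(W,\sigma)$ where $W$ is a vertex cover of $\Gamma$ and $\sigma\colon W\to\Omega$ is a function such that for each $ij\in E$ either $i\in W$ and $S(ij)\subseteq\sigma(i)$, or $j\in W$ and $S(ij)\subseteq\sigma(j)$. For pairs $(W,\sigma),(W',\sigma')$ with $W,W'\subseteq V$, $\sigma\colon W\to\Omega$, $\sigma'\colon W'\to\Omega$, write $(W,\sigma)\leq(W',\sigma')$ if $W\subseteq W'$ and $\sigma(i)\subseteq\sigma'(i)$ for all $i\in W$. An interval vertex cover is minimal if it is minimal in the set of all interval vertex covers with respect to this ordering. For such a pair set $Q_{W,\sigma}=(X_i^a\mid i\in W\text{ and }a\in\sigma(i))R$. *)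

theory Defs
  imports "HOL-Analysis.Finite_Cartesian_Product" "HOL-Library.Poly_Mapping"
    "HOL-Library.FuncSet"
begin

text \<open>The ordered additive monoid of non-negative reals.\<close>

typedef nnreal = "{x :: real. 0 \<le> x}"
  by auto

setup_lifting type_definition_nnreal

instantiation nnreal :: "{linorder, cancel_comm_monoid_add}"
begin

lift_definition zero_nnreal :: nnreal is 0 by simp
lift_definition plus_nnreal :: "nnreal \<Rightarrow> nnreal \<Rightarrow> nnreal" is "(+)" by simp
text \<open>Truncated subtraction; only needed for the type class.\<close>
lift_definition minus_nnreal :: "nnreal \<Rightarrow> nnreal \<Rightarrow> nnreal" is "\<lambda>x y. max 0 (x - y)" by simp
lift_definition less_eq_nnreal :: "nnreal \<Rightarrow> nnreal \<Rightarrow> bool" is "(\<le>)" .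
lift_definition less_nnreal :: "nnreal \<Rightarrow> nnreal \<Rightarrow> bool" is "(<)" .

instance
  by standard (transfer; auto simp: algebra_simps max_def)+

end

text \<open>
  With \<open>'n\<close> a finite type of variables, exponent vectors are elements of \<open>nnreal ^ 'n\<close>, and
  \<open>('n, 'a) rexp_poly\<close> is the monoid ring of this additive monoid over \<open>'a\<close>: finitely supported
  coefficient functions with the convolution product.
\<close>

type_synonym ('n, 'a) rexp_poly = "(nnreal ^ 'n) \<Rightarrow>\<^sub>0 'a"

definition monomial :: "nnreal ^ 'n \<Rightarrow> ('n::finite, 'a::comm_ring_1) rexp_poly" where
  "monomial m = Poly_Mapping.single m 1"

text \<open>\<open>var_pow i a\<close> is \<open>X\<^sub>i\<close> raised to the power \<open>a\<close>.\<close>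

definition var_pow :: "'n \<Rightarrow> nnreal \<Rightarrow> ('n::finite, 'a::comm_ring_1) rexp_poly" where
  "var_pow i a = monomial (axis i a)"

text \<open>Ideals of a commutative ring are the submodules of the ring as a module over itself.\<close>

lemma module_times: "module ((*) :: 'r::comm_ring_1 \<Rightarrow> 'r \<Rightarrow> 'r)"
  by (simp add: module_def algebra_simps)

definition ideal_generated :: "'r::comm_ring_1 set \<Rightarrow> 'r set" where
  "ideal_generated B = module.span (*) B"

definition monomial_ideal :: "('n::finite, 'a::comm_ring_1) rexp_poly set \<Rightarrow> bool" where
  "monomial_ideal L \<longleftrightarrow> (\<exists>M. L = ideal_generated (monomial ` M))"

definition m_irreducible :: "('n::finite, 'a::comm_ring_1) rexp_poly set \<Rightarrow> bool" where
  "m_irreducible L \<longleftrightarrow> monomial_ideal L \<and>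
     (\<forall>J K. monomial_ideal J \<and> monomial_ideal K \<and> L = J \<inter> K \<longrightarrow> L = J \<or> L = K)"

definition m_irreducible_decomposition ::
    "('n::finite, 'a::comm_ring_1) rexp_poly set \<Rightarrow> 'l set \<Rightarrow> ('l \<Rightarrow> ('n, 'a) rexp_poly set) \<Rightarrow> bool"
  where
  "m_irreducible_decomposition I \<Lambda> F \<longleftrightarrow>
     monomial_ideal I \<and> (\<forall>l\<in>\<Lambda>. m_irreducible (F l)) \<and> I = (\<Inter>l\<in>\<Lambda>. F l)"

definition irredundant :: "'l set \<Rightarrow> ('l \<Rightarrow> 'r set) \<Rightarrow> bool" where
  "irredundant \<Lambda> F \<longleftrightarrow> (\<forall>l\<in>\<Lambda>. \<forall>k\<in>\<Lambda>. l \<noteq> k \<longrightarrow> \<not> F l \<subseteq> F k)"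

text \<open>
  A graph with interval data is given by an edge set \<open>E\<close>, consisting of two-element subsets of
  the vertex set \<open>UNIV :: 'n set\<close>, and a function \<open>S\<close> whose values matter only on \<open>E\<close>.
\<close>

definition edges_of :: "('n::finite, 'a::comm_ring_1) rexp_poly set \<Rightarrow> 'n set set" where
  "edges_of I = {{i, j} | i j. i \<noteq> j \<and> (\<exists>a>0. var_pow i a * var_pow j a \<in> I)}"

definition interval_of :: "('n::finite, 'a::comm_ring_1) rexp_poly set \<Rightarrow> 'n set \<Rightarrow> nnreal set" where
  "interval_of I e =
     {a. 0 < a \<and> (\<exists>i j. i \<noteq> j \<and> e = {i, j} \<and> var_pow i a * var_pow j a \<in> I)}"

definition Omega :: "nnreal set set" where
  "Omega = {{a<..} | a. True} \<union> {{b..} | b. 0 < b}"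

definition vertex_cover :: "'n set set \<Rightarrow> 'n set \<Rightarrow> bool" where
  "vertex_cover E W \<longleftrightarrow> (\<forall>i j. {i, j} \<in> E \<longrightarrow> i \<in> W \<or> j \<in> W)"

text \<open>
  A function \<open>\<sigma> : W \<rightarrow> Omega\<close> is rendered as an element of the extensional function space, so
  that distinct pairs \<open>(W, \<sigma>)\<close> represent distinct mathematical pairs.
\<close>

definition interval_vertex_covers ::
    "'n set set \<Rightarrow> ('n set \<Rightarrow> nnreal set) \<Rightarrow> ('n set \<times> ('n \<Rightarrow> nnreal set)) set" where
  "interval_vertex_covers E S =
     {(W, \<sigma>). vertex_cover E W \<and> \<sigma> \<in> W \<rightarrow>\<^sub>E Omega \<and>
        (\<forall>i j. {i, j} \<in> E \<longrightarrow> (i \<in> W \<and> S {i, j} \<subseteq> \<sigma> i) \<or> (j \<in> W \<and> S {i, j} \<subseteq> \<sigma> j))}"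

fun pair_le :: "'n set \<times> ('n \<Rightarrow> nnreal set) \<Rightarrow> 'n set \<times> ('n \<Rightarrow> nnreal set) \<Rightarrow> bool" where
  "pair_le (W, \<sigma>) (W', \<sigma>') \<longleftrightarrow> W \<subseteq> W' \<and> (\<forall>i\<in>W. \<sigma> i \<subseteq> \<sigma>' i)"

definition min_interval_vertex_covers ::
    "'n set set \<Rightarrow> ('n set \<Rightarrow> nnreal set) \<Rightarrow> ('n set \<times> ('n \<Rightarrow> nnreal set)) set" where
  "min_interval_vertex_covers E S =
     {p \<in> interval_vertex_covers E S. \<forall>q \<in> interval_vertex_covers E S. pair_le q p \<longrightarrow> q = p}"

fun Q :: "'n set \<times> ('n \<Rightarrow> nnreal set) \<Rightarrow> ('n::finite, 'a::comm_ring_1) rexp_poly set" where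
  "Q (W, \<sigma>) = ideal_generated {var_pow i a | i a. i \<in> W \<and> a \<in> \<sigma> i}"

end

theory Submission
  imports Defs
begin

text \<open>
  The whole statement is about sets of exponent vectors. A monomial ideal consists of the
  polynomials supported in some set of exponent vectors that is closed under adding vectors
  (\<open>monomial_ideal_iff\<close>), and inclusions and intersections of such ideals are inclusions and
  intersections of these sets. Write \<open>U\<close> for the set of \<open>I\<close> and \<open>U\<^sub>p\<close> for the set of \<open>Q p\<close>, where
  \<open>p = (W, \<sigma>)\<close>. Then \<open>m \<in> U\<close> means that some edge \<open>{i, j}\<close> has both \<open>m\<^sub>i\<close> and \<open>m\<^sub>j\<close> in \<open>S {i, j}\<close>,
  and \<open>m \<in> U\<^sub>p\<close> means that \<open>m\<^sub>i \<in> \<sigma> i\<close> for some \<open>i \<in> W\<close>.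

  Each \<open>Q p\<close> is m-irreducible: if the least common multiple of two monomials lies in \<open>U\<^sub>p\<close>, then
  one coordinate witnesses this, and there the maximum is attained by one of the two monomials.
  So if \<open>Q p = J \<inter> K\<close>, monomials in \<open>J - Q p\<close> and in \<open>K - Q p\<close> cannot both exist.

  The covering condition gives \<open>U \<subseteq> U\<^sub>p\<close> for every cover. Conversely, if \<open>m \<notin> U\<close>, then the full
  vertex set with \<open>\<sigma> i = {m\<^sub>i<..}\<close> is an interval vertex cover: were \<open>S {i, j}\<close> contained in neither
  \<open>\<sigma> i\<close> nor \<open>\<sigma> j\<close>, it would reach down to \<open>m\<^sub>i\<close> and to \<open>m\<^sub>j\<close>, so that \<open>m \<in> U\<close>. This cover
  avoids \<open>m\<close> by construction (\<open>Inter_covers\<close>).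

  For minimal covers, the order on covers is the inclusion of the sets \<open>U\<^sub>p\<close>
  (\<open>pair_le_iff\<close>), which makes redundancy a violation of minimality. Any cover can be shrunk so
  that each \<open>\<sigma> i\<close> is the union of the intervals \<open>S e\<close> that it covers
  (\<open>edge_cover_below\<close>). There are only finitely many covers of this kind, so the minimal covers are
  among them, and every cover dominates a minimal one.
\<close>

section \<open>Exponent vectors and intervals\<close>

lemma nnreal_zero_le [simp]: "0 \<le> (x :: nnreal)"
  by transfer simp

lemma nnreal_not_less_zero [simp]: "\<not> x < (0 :: nnreal)"
  by (simp add: not_less)

lemma nnreal_le_imp_add:
  fixes x y :: nnreal
  assumes "x \<le> y"
  shows "y = x + (y - x)"
  using assms by transfer simp

lemma nnreal_le_add: "x \<le> x + (y :: nnreal)"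
  by transfer simp

lemma nnreal_ex_greater: "\<exists>y. (x :: nnreal) < y"
proof
  show "x < Abs_nnreal (Rep_nnreal x + 1)"
    using Rep_nnreal[of x] by (simp add: less_nnreal.rep_eq Abs_nnreal_inverse)
qed

text \<open>Divisibility of monomials is the componentwise order of their exponents.\<close>

lemma pointwise_le_imp_add:
  fixes m m' :: "nnreal ^ 'n"
  assumes "\<And>i. m $ i \<le> m' $ i"
  shows "\<exists>c. m' = m + c"
proof
  show "m' = m + (\<chi> i. m' $ i - m $ i)"
    using nnreal_le_imp_add[OF assms] by (simp add: vec_eq_iff)
qed

text \<open>
  An up-set of positive numbers is determined by its infimum and by whether it contains it. This
  description of \<open>Omega\<close> replaces the case distinction between the two kinds of rays, and it is
  visibly preserved by non-empty unions.
\<close>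

lemma Omega_iff:
  "T \<in> Omega \<longleftrightarrow> T \<noteq> {} \<and> 0 \<notin> T \<and> (\<forall>a\<in>T. \<forall>b\<ge>a. b \<in> T)"
proof
  assume "T \<in> Omega"
  then show "T \<noteq> {} \<and> 0 \<notin> T \<and> (\<forall>a\<in>T. \<forall>b\<ge>a. b \<in> T)"
    using nnreal_ex_greater by (auto simp: Omega_def not_less)
next
  assume T: "T \<noteq> {} \<and> 0 \<notin> T \<and> (\<forall>a\<in>T. \<forall>b\<ge>a. b \<in> T)"
  define R where "R = Rep_nnreal ` T"
  have R0: "R \<noteq> {}" and bdd: "bdd_below R"
    using T Rep_nnreal by (auto simp: R_def intro!: bdd_belowI[of _ 0])
  have c0: "0 \<le> Inf R"
    using R0 Rep_nnreal by (intro cInf_greatest) (auto simp: R_def)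
  define c where "c = Abs_nnreal (Inf R)"
  have Rep_c: "Rep_nnreal c = Inf R"
    using c0 by (simp add: c_def Abs_nnreal_inverse)
  have lower: "c \<le> a" if "a \<in> T" for a
    using that bdd by (simp add: less_eq_nnreal.rep_eq Rep_c R_def cInf_lower)
  have above: "b \<in> T" if "c < b" for b
  proof -
    have "Inf R < Rep_nnreal b"
      using that by (simp add: less_nnreal.rep_eq Rep_c)
    then obtain a where "a \<in> T" "Rep_nnreal a < Rep_nnreal b"
      using R0 bdd by (auto simp: cInf_less_iff R_def)
    then show ?thesis
      using T by (auto simp: less_eq_nnreal.rep_eq)
  qed
  show "T \<in> Omega"
  proof (cases "c \<in> T")
    case True
    then have "T = {c..}"
      using lower T by blast
    moreover have "0 < c"
      using True T nnreal_zero_le[of c] by (metis order.order_iff_strict)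
    ultimately show ?thesis by (auto simp: Omega_def)
  next
    case False
    then have "c < a" if "a \<in> T" for a
      using lower[OF that] that by (metis order.order_iff_strict)
    then have "T = {c<..}"
      using above by blast
    then show ?thesis by (auto simp: Omega_def)
  qed
qed

section \<open>Monomial ideals as supports\<close>

definition up_closed :: "(nnreal ^ 'n) set \<Rightarrow> bool" where
  "up_closed U \<longleftrightarrow> (\<forall>m\<in>U. \<forall>c. m + c \<in> U)"

definition support_ideal :: "(nnreal ^ 'n) set \<Rightarrow> ('n::finite, 'a::comm_ring_1) rexp_poly set" where
  "support_ideal U = {p. Poly_Mapping.keys p \<subseteq> U}"

text \<open>The exponents of the multiples of the monomials with exponents in \<open>M\<close> are the sums \<open>m + c\<close>.\<close>

lemma up_closed_shifts: "up_closed {m + c | m c. m \<in> M}"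
  unfolding up_closed_def
proof safe
  fix m c d assume "m \<in> M"
  then show "\<exists>m' c'. m + c + d = m' + c' \<and> m' \<in> M"
    by (intro exI[of _ m] exI[of _ "c + d"]) (simp add: add.assoc)
qed

lemma subset_shifts: "(M :: (nnreal ^ 'n) set) \<subseteq> {m + c | m c. m \<in> M}"
proof
  fix m assume "m \<in> M"
  then show "m \<in> {m + c | m c. m \<in> M}"
    by (intro CollectI exI[of _ m] exI[of _ 0]) simp
qed

lemma up_closedD:
  assumes "up_closed U" "m \<in> U" "\<And>i. m $ i \<le> m' $ i"
  shows "m' \<in> U"
  using assms pointwise_le_imp_add[of m m'] by (auto simp: up_closed_def)

lemma monomial_in_support_ideal [simp]: "monomial m \<in> support_ideal U \<longleftrightarrow> m \<in> U"
  by (simp add: monomial_def support_ideal_def)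

lemma support_ideal_subset_iff:
  "(support_ideal U :: ('n::finite, 'a::comm_ring_1) rexp_poly set) \<subseteq> support_ideal V \<longleftrightarrow> U \<subseteq> V"
proof
  assume sub: "(support_ideal U :: ('n, 'a) rexp_poly set) \<subseteq> support_ideal V"
  show "U \<subseteq> V"
  proof
    fix m assume "m \<in> U"
    then have "(monomial m :: ('n, 'a) rexp_poly) \<in> support_ideal V"
      using sub by (meson monomial_in_support_ideal subsetD)
    then show "m \<in> V" by simp
  qed
qed (auto simp: support_ideal_def)

lemma support_ideal_eq_iff:
  "(support_ideal U :: ('n::finite, 'a::comm_ring_1) rexp_poly set) = support_ideal V \<longleftrightarrow> U = V"
  by (simp add: set_eq_subset support_ideal_subset_iff)

lemma support_ideal_Int: "support_ideal U \<inter> support_ideal V = support_ideal (U \<inter> V)"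
  by (auto simp: support_ideal_def)

lemma support_ideal_INT: "(\<Inter>l\<in>L. support_ideal (U l)) = support_ideal (\<Inter>l\<in>L. U l)"
  by (auto simp: support_ideal_def)

text \<open>
  The right-hand side is an ideal because the support of a product lies in the sum of the supports.
  Conversely, a polynomial is the sum of its terms, each of which is here a multiple of a generator.
\<close>

lemma ideal_generated_monomials:
  "ideal_generated (monomial ` M :: ('n::finite, 'a::comm_ring_1) rexp_poly set) =
    support_ideal {m + c | m c. m \<in> M}"
    (is "?I = support_ideal ?U")
proof -
  interpret module "(*) :: ('n, 'a) rexp_poly \<Rightarrow> _"
    by (rule module_times)
  have scale: "q * p \<in> support_ideal ?U" if "p \<in> support_ideal ?U"
    for p q :: "('n, 'a) rexp_poly"
  proof -
    have "k \<in> ?U" if k: "k \<in> Poly_Mapping.keys (q * p)" for k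
    proof -
      obtain a b where "k = a + b" "b \<in> Poly_Mapping.keys p"
        using k keys_mult[of q p] by blast
      then have "k = b + a" "b \<in> ?U"
        using \<open>p \<in> _\<close> by (auto simp: support_ideal_def add.commute)
      then show ?thesis
        using up_closed_shifts[of M] unfolding up_closed_def by blast
    qed
    then show ?thesis by (auto simp: support_ideal_def)
  qed
  have "subspace (support_ideal ?U :: ('n, 'a) rexp_poly set)"
  proof (rule subspaceI)
    fix p q :: "('n, 'a) rexp_poly"
    assume "p \<in> support_ideal ?U" "q \<in> support_ideal ?U"
    then show "p + q \<in> support_ideal ?U"
      using Poly_Mapping.keys_add[of p q] unfolding support_ideal_def by blast
  qed (simp add: support_ideal_def, rule scale)
  moreover have "monomial m \<in> support_ideal ?U" if "m \<in> M" for m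
    unfolding monomial_in_support_ideal using that subset_shifts by blast
  ultimately have "?I \<subseteq> support_ideal ?U"
    unfolding ideal_generated_def by (intro span_minimal) auto
  moreover have "p \<in> ?I" if p: "p \<in> support_ideal ?U" for p :: "('n, 'a) rexp_poly"
  proof -
    have "Poly_Mapping.single k a \<in> ?I" if "k \<in> ?U" for k and a :: 'a
    proof -
      obtain m c where k: "k = m + c" and m: "m \<in> M"
        using \<open>k \<in> ?U\<close> by auto
      have "Poly_Mapping.single k a = Poly_Mapping.single c a * monomial m"
        by (simp add: k monomial_def mult_single add.commute)
      then show ?thesis
        using m by (simp add: ideal_generated_def span_scale span_base)
    qed
    moreover have "Poly_Mapping.keys p \<subseteq> ?U"
      using p unfolding support_ideal_def by (rule CollectD)
    ultimately have "(\<Sum>k\<in>Poly_Mapping.keys p. Poly_Mapping.single k (Poly_Mapping.lookup p k)) \<in> ?I"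
      unfolding ideal_generated_def by (intro span_sum) blast
    moreover have "(\<Sum>k\<in>Poly_Mapping.keys p. Poly_Mapping.single k (Poly_Mapping.lookup p k)) = p"
      by (rule poly_mapping_eqI)
        (auto simp: lookup_sum lookup_single when_def in_keys_iff sum.delta)
    ultimately show ?thesis by simp
  qed
  ultimately show ?thesis by blast
qed

lemma monomial_ideal_iff:
  "monomial_ideal L \<longleftrightarrow> (\<exists>U. up_closed U \<and> L = support_ideal U)"
proof
  assume "monomial_ideal L"
  then obtain M where "L = support_ideal {m + c | m c. m \<in> M}"
    by (auto simp: monomial_ideal_def ideal_generated_monomials)
  then show "\<exists>U. up_closed U \<and> L = support_ideal U"
    using up_closed_shifts by blast
next
  assume "\<exists>U. up_closed U \<and> L = support_ideal U"
  then obtain U where U: "up_closed U" "L = support_ideal U" by blast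
  have "{m + c | m c. m \<in> U} = U"
    using U(1) subset_shifts[of U] unfolding up_closed_def by blast
  then show "monomial_ideal L"
    unfolding monomial_ideal_def ideal_generated_monomials U(2)
    by (intro exI[of _ U]) (simp only:)
qed

text \<open>
  The componentwise maximum is the exponent of a least common multiple. If \<open>U = V \<inter> W\<close> with
  \<open>f \<in> V - U\<close> and \<open>g \<in> W - U\<close>, then the maximum of \<open>f\<close> and \<open>g\<close> lies in \<open>V\<close> and in \<open>W\<close>, which the
  hypothesis on \<open>U\<close> excludes.
\<close>

lemma m_irreducible_support_ideal:
  assumes U: "up_closed U"
    and prime: "\<And>f g. (\<chi> i. max (f $ i) (g $ i)) \<in> U \<Longrightarrow> f \<in> U \<or> g \<in> U"
  shows "m_irreducible (support_ideal U :: ('n::finite, 'a::comm_ring_1) rexp_poly set)"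
  unfolding m_irreducible_def
proof (intro conjI allI impI)
  show "monomial_ideal (support_ideal U :: ('n, 'a) rexp_poly set)"
    using U by (auto simp: monomial_ideal_iff)
  fix J K :: "('n, 'a) rexp_poly set"
  assume JK: "monomial_ideal J \<and> monomial_ideal K \<and> support_ideal U = J \<inter> K"
  then obtain V W where V: "up_closed V" "J = support_ideal V"
    and W: "up_closed W" "K = support_ideal W"
    by (auto simp: monomial_ideal_iff)
  have UVW: "U = V \<inter> W"
    using JK V W by (simp add: support_ideal_Int support_ideal_eq_iff)
  have "V \<subseteq> U \<or> W \<subseteq> U"
  proof (rule ccontr)
    assume "\<not> (V \<subseteq> U \<or> W \<subseteq> U)"
    then obtain f g where fg: "f \<in> V" "f \<notin> U" "g \<in> W" "g \<notin> U" by blast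
    have "(\<chi> i. max (f $ i) (g $ i)) \<in> V" "(\<chi> i. max (f $ i) (g $ i)) \<in> W"
      by (rule up_closedD[OF V(1) fg(1)] up_closedD[OF W(1) fg(3)]; simp)+
    then show False
      using prime fg UVW by blast
  qed
  then show "support_ideal U = J \<or> support_ideal U = K"
    using UVW V W by (auto simp: support_ideal_eq_iff)
qed

section \<open>The ideals of interval vertex covers\<close>

fun cover_exponents :: "'n set \<times> ('n \<Rightarrow> nnreal set) \<Rightarrow> (nnreal ^ 'n::finite) set" where
  "cover_exponents (W, \<sigma>) = {m. \<exists>i\<in>W. m $ i \<in> \<sigma> i}"

lemma Q_eq_support_ideal:
  assumes "\<sigma> \<in> W \<rightarrow> Omega"
  shows "(Q (W, \<sigma>) :: ('n::finite, 'a::comm_ring_1) rexp_poly set)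
    = support_ideal (cover_exponents (W, \<sigma>))"
proof -
  have "{var_pow i a :: ('n, 'a) rexp_poly | i a. i \<in> W \<and> a \<in> \<sigma> i} =
      monomial ` {axis i a | i a. i \<in> W \<and> a \<in> \<sigma> i}"
    by (auto simp: var_pow_def)
  moreover have "{m + c | m c. m \<in> {axis i a | i a. i \<in> W \<and> a \<in> \<sigma> i}} = cover_exponents (W, \<sigma>)"
    (is "?L = ?R")
  proof
    show "?L \<subseteq> ?R"
    proof
      fix x assume "x \<in> ?L"
      then obtain i a c where x: "x = axis i a + c" "i \<in> W" "a \<in> \<sigma> i" by blast
      have "a \<le> x $ i"
        by (simp add: x(1) axis_def nnreal_le_add)
      then have "x $ i \<in> \<sigma> i"
        using assms x by (auto simp: Pi_iff Omega_iff)
      then show "x \<in> ?R" using x(2) by auto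
    qed
    show "?R \<subseteq> ?L"
    proof
      fix x assume "x \<in> ?R"
      then obtain i where i: "i \<in> W" "x $ i \<in> \<sigma> i" by auto
      have "\<exists>c. x = axis i (x $ i) + c"
        by (rule pointwise_le_imp_add) (simp add: axis_def)
      then show "x \<in> ?L" using i by blast
    qed
  qed
  ultimately show ?thesis
    by (simp only: Q.simps ideal_generated_monomials)
qed

lemma m_irreducible_Q:
  assumes "\<sigma> \<in> W \<rightarrow> Omega"
  shows "m_irreducible (Q (W :: 'n::finite set, \<sigma>) :: ('n, 'a::comm_ring_1) rexp_poly set)"
  unfolding Q_eq_support_ideal[OF assms]
proof (rule m_irreducible_support_ideal)
  show "up_closed (cover_exponents (W, \<sigma>))"
    unfolding up_closed_def
  proof (intro ballI allI)
    fix m c assume "m \<in> cover_exponents (W, \<sigma>)"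
    then obtain i where i: "i \<in> W" "m $ i \<in> \<sigma> i" by auto
    then have "(m + c) $ i \<in> \<sigma> i"
      using assms nnreal_le_add[of "m $ i" "c $ i"] by (simp add: Pi_iff Omega_iff)
    then show "m + c \<in> cover_exponents (W, \<sigma>)"
      using i(1) by auto
  qed
next
  fix f g :: "nnreal ^ 'n"
  assume "(\<chi> i. max (f $ i) (g $ i)) \<in> cover_exponents (W, \<sigma>)"
  then obtain i where "i \<in> W" "max (f $ i) (g $ i) \<in> \<sigma> i" by auto
  then have "i \<in> W" "f $ i \<in> \<sigma> i \<or> g $ i \<in> \<sigma> i"
    by (auto simp only: max_def split: if_split_asm)
  then show "f \<in> cover_exponents (W, \<sigma>) \<or> g \<in> cover_exponents (W, \<sigma>)"
    by auto
qed

text \<open>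
  The inclusion of the ideals is tested on powers of one variable: \<open>X\<^sub>i\<^sup>x\<close> can lie in the second
  ideal only because of the vertex \<open>i\<close>, since intervals in \<open>Omega\<close> do not contain \<open>0\<close>. As they are
  also non-empty, such powers exist for every \<open>i \<in> W\<close>.
\<close>

lemma cover_exponents_subset_iff:
  assumes \<sigma>: "\<sigma> \<in> W \<rightarrow> Omega" and \<tau>: "\<tau> \<in> V \<rightarrow> Omega"
  shows "cover_exponents (W, \<sigma>) \<subseteq> cover_exponents (V, \<tau>) \<longleftrightarrow> pair_le (W, \<sigma>) (V, \<tau>)"
proof
  assume sub: "cover_exponents (W, \<sigma>) \<subseteq> cover_exponents (V, \<tau>)"
  have *: "i \<in> V \<and> x \<in> \<tau> i" if "i \<in> W" "x \<in> \<sigma> i" for i x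
  proof -
    have "axis i x \<in> cover_exponents (W, \<sigma>)"
      using that by (auto simp: axis_def)
    then obtain j where j: "j \<in> V" "axis i x $ j \<in> \<tau> j"
      using sub by auto
    then have "axis i x $ j \<noteq> 0"
      using \<tau> by (auto simp: Pi_iff Omega_iff)
    then have "j = i" by (simp add: axis_def split: if_splits)
    then show ?thesis using j by (simp add: axis_def)
  qed
  moreover have "\<sigma> i \<noteq> {}" if "i \<in> W" for i
    using \<sigma> that by (auto simp: Pi_iff Omega_iff)
  ultimately have "i \<in> V \<and> \<sigma> i \<subseteq> \<tau> i" if "i \<in> W" for i
    using that by blast
  then show "pair_le (W, \<sigma>) (V, \<tau>)" by auto
qed auto

section \<open>Graphs with interval data\<close>

locale interval_graph =
  fixes E :: "'n::finite set set" and S :: "'n set \<Rightarrow> nnreal set"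
  assumes interval_Omega: "e \<in> E \<Longrightarrow> S e \<in> Omega"
begin

abbreviation "covers \<equiv> interval_vertex_covers E S"
abbreviation "min_covers \<equiv> min_interval_vertex_covers E S"

definition edge_exponents :: "(nnreal ^ 'n) set" where
  "edge_exponents = {m. \<exists>i j. {i, j} \<in> E \<and> m $ i \<in> S {i, j} \<and> m $ j \<in> S {i, j}}"

lemma interval_up: "e \<in> E \<Longrightarrow> a \<in> S e \<Longrightarrow> a \<le> b \<Longrightarrow> b \<in> S e"
  using interval_Omega by (auto simp: Omega_iff)

lemma covers_iff:
  "(W, \<sigma>) \<in> covers \<longleftrightarrow> \<sigma> \<in> W \<rightarrow>\<^sub>E Omega \<and>
     (\<forall>i j. {i, j} \<in> E \<longrightarrow> (i \<in> W \<and> S {i, j} \<subseteq> \<sigma> i) \<or> (j \<in> W \<and> S {i, j} \<subseteq> \<sigma> j))"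
  by (auto simp: interval_vertex_covers_def vertex_cover_def)

lemma covers_Omega: "(W, \<sigma>) \<in> covers \<Longrightarrow> \<sigma> \<in> W \<rightarrow> Omega"
  by (auto simp: covers_iff PiE_def)

lemma Q_cover: "p \<in> covers \<Longrightarrow> Q p = support_ideal (cover_exponents p)"
  by (cases p) (simp only: Q_eq_support_ideal covers_Omega)

lemma m_irreducible_Q_cover: "p \<in> covers \<Longrightarrow> m_irreducible (Q p)"
  by (cases p) (simp only: m_irreducible_Q covers_Omega)

lemma Inter_Q:
  assumes "P \<subseteq> covers"
  shows "(\<Inter>p\<in>P. Q p) = support_ideal (\<Inter>p\<in>P. cover_exponents p)"
proof -
  have "(\<Inter>p\<in>P. Q p) = (\<Inter>p\<in>P. support_ideal (cover_exponents p))"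
    by (rule INF_cong[OF refl]) (rule Q_cover[OF subsetD[OF assms]])
  then show ?thesis by (simp only: support_ideal_INT)
qed

lemma pair_le_iff:
  assumes "p \<in> covers" "q \<in> covers"
  shows "pair_le p q \<longleftrightarrow> cover_exponents p \<subseteq> cover_exponents q"
  using assms by (cases p; cases q) (simp only: cover_exponents_subset_iff covers_Omega)

lemma pair_le_antisym:
  assumes "p \<in> covers" "q \<in> covers" "pair_le p q" "pair_le q p"
  shows "p = q"
proof -
  obtain W \<sigma> V \<tau> where pq: "p = (W, \<sigma>)" "q = (V, \<tau>)" by (metis surj_pair)
  have W: "W = V"
    using assms(3,4) by (auto simp: pq)
  have "\<sigma> = \<tau>"
  proof (rule PiE_ext)
    show "\<sigma> \<in> W \<rightarrow>\<^sub>E Omega" "\<tau> \<in> W \<rightarrow>\<^sub>E Omega"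
      using assms(1,2) by (simp_all only: pq covers_iff W)
    show "\<sigma> i = \<tau> i" if "i \<in> W" for i
      using assms(3,4) that W by (auto simp: pq)
  qed
  then show ?thesis by (simp add: pq W)
qed

text \<open>
  A vector \<open>m\<close> outside \<open>edge_exponents\<close> is avoided by the cover \<open>(UNIV, \<lambda>i. {m $ i <..})\<close>, whose
  intervals are the largest ones that miss the coordinates of \<open>m\<close>.
\<close>

lemma Inter_covers: "(\<Inter>p\<in>covers. cover_exponents p) = edge_exponents"
proof
  show "edge_exponents \<subseteq> (\<Inter>p\<in>covers. cover_exponents p)"
    by (fastforce simp: edge_exponents_def covers_iff)
  show "(\<Inter>p\<in>covers. cover_exponents p) \<subseteq> edge_exponents"
  proof (rule subsetI, rule ccontr)
    fix m :: "nnreal ^ 'n"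
    assume m: "m \<in> (\<Inter>p\<in>covers. cover_exponents p)" "m \<notin> edge_exponents"
    define \<sigma> where "\<sigma> i = {m $ i <..}" for i
    have "S {i, j} \<subseteq> \<sigma> i \<or> S {i, j} \<subseteq> \<sigma> j" if e: "{i, j} \<in> E" for i j
    proof (rule ccontr)
      assume "\<not> ?thesis"
      then obtain a b where "a \<in> S {i, j}" "a \<le> m $ i" "b \<in> S {i, j}" "b \<le> m $ j"
        by (auto simp: \<sigma>_def subset_iff not_less)
      \<comment> \<open>As \<open>S {i, j}\<close> is an up-set, it contains both coordinates, so \<open>m\<close> would be in the set.\<close>
      then show False
        using m(2) e interval_up[OF e] unfolding edge_exponents_def by blast
    qed
    moreover have "\<sigma> i \<in> Omega" for i
      by (auto simp: \<sigma>_def Omega_def)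
    ultimately have "(UNIV, \<sigma>) \<in> covers"
      by (auto simp: covers_iff)
    then have "m \<in> cover_exponents (UNIV, \<sigma>)"
      using m(1) by blast
    then show False by (simp add: \<sigma>_def)
  qed
qed

text \<open>
  Unions of intervals rather than single intervals \<open>S e\<close> are allowed as values. The intervals form a
  chain, so this makes no difference, but unions do not require choosing a largest one.
\<close>

definition edge_covers :: "('n set \<times> ('n \<Rightarrow> nnreal set)) set" where
  "edge_covers = {(W, \<sigma>). (W, \<sigma>) \<in> covers \<and> (\<forall>i\<in>W. \<exists>N\<subseteq>E. \<sigma> i = \<Union> (S ` N))}"

lemma finite_edge_covers: "finite edge_covers"
proof (rule finite_subset)
  let ?T = "(\<lambda>N. \<Union> (S ` N)) ` Pow E"
  show "edge_covers \<subseteq> (SIGMA W:UNIV. W \<rightarrow>\<^sub>E ?T)"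
  proof
    fix p assume "p \<in> edge_covers"
    then obtain W \<sigma> where p: "p = (W, \<sigma>)" "(W, \<sigma>) \<in> edge_covers"
      by (cases p) simp
    then have "\<sigma> \<in> extensional W" "\<forall>i\<in>W. \<sigma> i \<in> ?T"
      by (auto simp: edge_covers_def covers_iff PiE_iff)
    then have "\<sigma> \<in> W \<rightarrow>\<^sub>E ?T" by (simp only: PiE_iff)
    then show "p \<in> (SIGMA W:UNIV. W \<rightarrow>\<^sub>E ?T)" by (simp only: p SigmaI UNIV_I)
  qed
  show "finite (SIGMA W:(UNIV :: 'n set set). W \<rightarrow>\<^sub>E ?T)"
    by (intro finite_SigmaI finite_PiE) auto
qed

text \<open>
  Shrink \<open>\<sigma> i\<close> to the union of the intervals \<open>S e\<close> of the edges \<open>e\<close> at \<open>i\<close> that \<open>\<sigma> i\<close> contains, and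
  drop \<open>i\<close> if there is no such edge. Every edge that was covered at \<open>i\<close> is still covered there.
\<close>

lemma edge_cover_below:
  assumes "p \<in> covers"
  shows "\<exists>q\<in>edge_covers. pair_le q p"
proof -
  obtain W \<sigma> where p: "p = (W, \<sigma>)" by (metis surj_pair)
  note cov = assms[unfolded p covers_iff]
  define N where "N i = {e \<in> E. i \<in> e \<and> S e \<subseteq> \<sigma> i}" for i
  define W' where "W' = {i \<in> W. N i \<noteq> {}}"
  define \<tau> where "\<tau> = (\<lambda>i\<in>W'. \<Union> (S ` N i))"
  have N: "N i \<subseteq> E" for i by (auto simp: N_def)
  have "\<tau> i \<in> Omega" if "i \<in> W'" for i
  proof -
    have "S e \<in> Omega" if "e \<in> N i" for e
      using that N interval_Omega by blast
    moreover have "N i \<noteq> {}" using that by (simp add: W'_def)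
    ultimately have "\<Union> (S ` N i) \<in> Omega"
      unfolding Omega_iff by (simp add: ex_in_conv[symmetric]) blast
    then show ?thesis using that by (simp add: \<tau>_def)
  qed
  then have "\<tau> \<in> W' \<rightarrow>\<^sub>E Omega" by (auto simp: \<tau>_def)
  moreover have *: "k \<in> W' \<and> S e \<subseteq> \<tau> k" if "e \<in> E" "k \<in> e" "k \<in> W" "S e \<subseteq> \<sigma> k" for k e
    using that by (auto simp: W'_def \<tau>_def N_def)
  have "(i \<in> W' \<and> S {i, j} \<subseteq> \<tau> i) \<or> (j \<in> W' \<and> S {i, j} \<subseteq> \<tau> j)" if "{i, j} \<in> E" for i j
  proof -
    have "(i \<in> W \<and> S {i, j} \<subseteq> \<sigma> i) \<or> (j \<in> W \<and> S {i, j} \<subseteq> \<sigma> j)"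
      using cov that by (simp only:)
    then show ?thesis
      using that *[of "{i, j}" i] *[of "{i, j}" j] by fast
  qed
  ultimately have "(W', \<tau>) \<in> covers"
    by (auto simp: covers_iff)
  then have "(W', \<tau>) \<in> edge_covers"
    using N by (auto simp: edge_covers_def \<tau>_def)
  moreover have "pair_le (W', \<tau>) p"
    by (auto simp: p W'_def \<tau>_def N_def)
  ultimately show ?thesis by blast
qed

lemma edge_covers_subset: "edge_covers \<subseteq> covers"
  by (auto simp: edge_covers_def)

lemma min_covers_subset: "min_covers \<subseteq> covers"
  by (auto simp: min_interval_vertex_covers_def)

lemma finite_min_covers: "finite min_covers"
proof (rule finite_subset[OF _ finite_edge_covers])
  show "min_covers \<subseteq> edge_covers"
  proof
    fix p assume p: "p \<in> min_covers"
    then obtain q where q: "q \<in> edge_covers" "pair_le q p"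
      using edge_cover_below min_covers_subset by blast
    then have "q = p"
      using p edge_covers_subset unfolding min_interval_vertex_covers_def by blast
    then show "p \<in> edge_covers" using q(1) by simp
  qed
qed

text \<open>
  A cover with minimal exponent set among the finitely many \<open>edge_covers\<close> is minimal
  among all covers, because below every competitor there is another member of \<open>edge_covers\<close>.
\<close>

lemma min_cover_below:
  assumes "p \<in> covers"
  shows "\<exists>q\<in>min_covers. cover_exponents q \<subseteq> cover_exponents p"
proof -
  have below: "\<exists>q\<in>edge_covers. cover_exponents q \<subseteq> cover_exponents p" if p: "p \<in> covers" for p
  proof -
    obtain q where "q \<in> edge_covers" "pair_le q p"
      using edge_cover_below[OF p] by blast
    then show ?thesis
      using pair_le_iff[of q p] p edge_covers_subset by blast
  qed
  then obtain q0 where q0: "q0 \<in> edge_covers" "cover_exponents q0 \<subseteq> cover_exponents p"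
    using assms by blast
  obtain X where X: "X \<in> cover_exponents ` edge_covers" "X \<subseteq> cover_exponents q0"
    and X_min: "\<And>Y. Y \<in> cover_exponents ` edge_covers \<Longrightarrow> Y \<subseteq> X \<Longrightarrow> X = Y"
    using finite_has_minimal2[of "cover_exponents ` edge_covers" "cover_exponents q0"]
      finite_edge_covers q0(1) by (metis finite_imageI imageI)
  then obtain q where q: "q \<in> edge_covers" and Xq: "X = cover_exponents q" by blast
  have minimal: "cover_exponents r = cover_exponents q"
    if "r \<in> edge_covers" "cover_exponents r \<subseteq> cover_exponents q" for r
    using X_min[of "cover_exponents r"] that Xq by simp
  have qc: "q \<in> covers" using q edge_covers_subset by blast
  have "r = q" if r: "r \<in> covers" "pair_le r q" for r
  proof (rule pair_le_antisym[OF r(1) qc r(2)])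
    obtain s where "s \<in> edge_covers" "cover_exponents s \<subseteq> cover_exponents r"
      using below r(1) by blast
    then show "pair_le q r"
      using minimal[of s] r qc pair_le_iff[of r q] pair_le_iff[of q r] by blast
  qed
  then have "q \<in> min_covers"
    using qc by (simp add: min_interval_vertex_covers_def)
  then show ?thesis using X(2) Xq q0(2) by blast
qed

lemma Inter_min_covers: "(\<Inter>p\<in>min_covers. cover_exponents p) = edge_exponents"
  unfolding Inter_covers[symmetric] using min_cover_below min_covers_subset by blast

lemma irredundant_min_covers:
  "irredundant min_covers (Q :: _ \<Rightarrow> ('n, 'a::comm_ring_1) rexp_poly set)"
  unfolding irredundant_def
proof (intro ballI impI notI)
  fix p q
  assume pq: "p \<in> min_covers" "q \<in> min_covers" "p \<noteq> q"
    and sub: "(Q p :: ('n, 'a) rexp_poly set) \<subseteq> Q q"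
  have c: "p \<in> covers" "q \<in> covers" using pq min_covers_subset by auto
  then have "pair_le p q"
    using sub by (simp add: Q_cover support_ideal_subset_iff pair_le_iff)
  then show False
    using pq c by (simp add: min_interval_vertex_covers_def)
qed

end

section \<open>The decomposition\<close>

lemma var_pow_mult: "var_pow i a * var_pow j b = monomial (axis i a + axis j b)"
  by (simp add: var_pow_def monomial_def mult_single)

theorem theorem3p18:
  fixes I G :: "('n::finite, 'a::comm_ring_1) rexp_poly set"
  assumes "G \<noteq> {}"
    and "G \<subseteq> {var_pow i a * var_pow j a | i j a. i \<noteq> j \<and> 0 < a}"
    and "I = ideal_generated G"
  shows "m_irreducible_decomposition I
           (interval_vertex_covers (edges_of I) (interval_of I)) Q
       \<and> m_irreducible_decomposition I
           (min_interval_vertex_covers (edges_of I) (interval_of I)) Q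
       \<and> irredundant (min_interval_vertex_covers (edges_of I) (interval_of I))
           (Q :: _ \<Rightarrow> ('n, 'a) rexp_poly set)
       \<and> finite (min_interval_vertex_covers (edges_of I) (interval_of I))"
proof -
  let ?m = "\<lambda>i j a. axis i a + axis j a :: nnreal ^ 'n"
  define M where "M = {?m i j a | i j a.
    i \<noteq> j \<and> 0 < a \<and> (monomial (?m i j a) :: ('n, 'a) rexp_poly) \<in> G}"
  define U where "U = {m + c | m c. m \<in> M}"
  have "G = monomial ` M"
    using assms(2) by (fastforce simp: M_def var_pow_mult)
  then have I: "I = support_ideal U"
    by (simp add: assms(3) ideal_generated_monomials U_def)
  have U: "up_closed U"
    unfolding U_def by (rule up_closed_shifts)
  have mem: "?m i j a \<in> U \<Longrightarrow> a \<le> x $ i \<Longrightarrow> a \<le> x $ j \<Longrightarrow> i \<noteq> j \<Longrightarrow> x \<in> U" for i j a x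
    by (erule up_closedD[OF U]) (auto simp: axis_def)
  have mon: "?m i j b \<in> U" if "?m i j a \<in> U" "a \<le> b" "i \<noteq> j" for i j a b
    by (rule mem[OF that(1)]) (use that in \<open>auto simp: axis_def\<close>)
  have edges: "edges_of I = {{i, j} | i j. i \<noteq> j \<and> (\<exists>a>0. ?m i j a \<in> U)}"
    by (simp add: edges_of_def I var_pow_mult)
  have interval: "interval_of I {i, j} = {a. 0 < a \<and> ?m i j a \<in> U}" if "i \<noteq> j" for i j
    using that by (auto simp: interval_of_def I var_pow_mult doubleton_eq_iff add.commute)
  interpret interval_graph "edges_of I" "interval_of I"
  proof
    fix e assume "e \<in> edges_of I"
    then obtain i j a where e: "i \<noteq> j" "e = {i, j}" "0 < a" "?m i j a \<in> U"
      by (auto simp: edges)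
    show "interval_of I e \<in> Omega"
      using e mon[OF _ _ e(1)] by (auto simp: Omega_iff interval)
  qed
  \<comment> \<open>The edges and intervals, which are read off from \<open>I\<close>, in turn determine \<open>I\<close>.\<close>
  have exps: "edge_exponents = U"
  proof
    show "edge_exponents \<subseteq> U"
    proof
      fix x assume "x \<in> edge_exponents"
      then obtain i j where e: "{i, j} \<in> edges_of I" "x $ i \<in> interval_of I {i, j}"
        "x $ j \<in> interval_of I {i, j}" by (auto simp: edge_exponents_def)
      then have ij: "i \<noteq> j" by (auto simp: edges doubleton_eq_iff)
      \<comment> \<open>The largest \<open>a\<close> for which \<open>X\<^sub>i\<^sup>a X\<^sub>j\<^sup>a\<close> divides the monomial with exponent \<open>x\<close>.\<close>
      have "?m i j (min (x $ i) (x $ j)) \<in> U"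
        using e by (auto simp: interval[OF ij] min_def)
      then show "x \<in> U" by (rule mem) (use ij in auto)
    qed
    show "U \<subseteq> edge_exponents"
    proof
      fix x assume "x \<in> U"
      then obtain m c where m: "m \<in> M" "x = m + c"
        by (auto simp: U_def)
      then obtain i j a where "i \<noteq> j" "0 < a" "m = ?m i j a"
        unfolding M_def by blast
      with m have x: "i \<noteq> j" "0 < a" "?m i j a \<in> M" "x = ?m i j a + c"
        by simp_all
      have a: "?m i j a \<in> U"
        using x(3) subset_shifts unfolding U_def by blast
      have "a \<le> x $ i" "a \<le> x $ j"
        using x(1) by (simp_all add: x(4) axis_def nnreal_le_add)
      then have "x $ i \<in> interval_of I {i, j}" "x $ j \<in> interval_of I {i, j}"
        using mon[OF a _ x(1)] x(2) by (auto simp: interval[OF x(1)])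
      moreover have "{i, j} \<in> edges_of I"
        using x a by (auto simp: edges)
      ultimately show "x \<in> edge_exponents"
        unfolding edge_exponents_def by blast
    qed
  qed
  have mI: "monomial_ideal I"
    using U I by (auto simp: monomial_ideal_iff)
  have "I = (\<Inter>p\<in>covers. Q p)"
    by (rule trans[OF I]) (simp only: Inter_Q[OF order_refl] Inter_covers exps)
  moreover have "I = (\<Inter>p\<in>min_covers. Q p)"
    by (rule trans[OF I]) (simp only: Inter_Q[OF min_covers_subset] Inter_min_covers exps)
  ultimately show ?thesis
    unfolding m_irreducible_decomposition_def
    using mI m_irreducible_Q_cover min_covers_subset irredundant_min_covers finite_min_covers
    by (intro conjI ballI) (assumption | blast)+
qed

end
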